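(* For a Tychonoff space $Y$ the following assertions are equivalent: (i) $Y$ is a locally pseudocompact $k_{\mathbb{R}}$-space; (ii) $X\times Y$ is a $k_{\mathbb{R}}$-space for each (Tychonoff) $k_{\mathbb{R}}$-space $X$; (iii) $X\times Y$ is a $k_{\mathbb{R}}$-space for each (Tychonoff) Fréchet–Urysohn space $X$.
   Context: All spaces are assumed to be Tychonoff. A function $f:X\to\mathbb{R}$ is $k$-continuous if its restriction to every compact subset of $X$ is continuous; $X$ is a $k_{\mathbb{R}}$-space if every $k$-continuous function $f:X\to\mathbb{R}$ is continuous. A space is pseudocompact if every continuous real-valued function on it is bounded; $X$ is locally pseudocompact if every point of $X$ has a neighborhood which is a pseudocompact space. A space $X$ is Fréchet–Urysohn if for every $A\subseteq X$ and every point $a\in\overline{A}$ there is a sequence in $A$ converging to $a$. *)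

theory Defs
  imports "HOL-Analysis.Analysis" "HOL-Library.Equipollence"
begin

definition tychonoff_space :: "'a topology \<Rightarrow> bool" where
  "tychonoff_space X \<longleftrightarrow> completely_regular_space X \<and> Hausdorff_space X"

definition k_continuous :: "'a topology \<Rightarrow> ('a \<Rightarrow> real) \<Rightarrow> bool" where
  "k_continuous X f \<longleftrightarrow>
     (\<forall>K. compactin X K \<longrightarrow> continuous_map (subtopology X K) euclideanreal f)"

definition kR_space :: "'a topology \<Rightarrow> bool" where
  "kR_space X \<longleftrightarrow> (\<forall>f. k_continuous X f \<longrightarrow> continuous_map X euclideanreal f)"

definition pseudocompact_space :: "'a topology \<Rightarrow> bool" where
  "pseudocompact_space X \<longleftrightarrow>
     (\<forall>f. continuous_map X euclideanreal f \<longrightarrow> bounded (f ` topspace X))"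

text \<open>Neighbourhoods are not required to be open.\<close>

definition locally_pseudocompact_space :: "'a topology \<Rightarrow> bool" where
  "locally_pseudocompact_space X \<longleftrightarrow>
     (\<forall>x \<in> topspace X. \<exists>U N. openin X U \<and> x \<in> U \<and> U \<subseteq> N \<and> N \<subseteq> topspace X \<and>
        pseudocompact_space (subtopology X N))"

definition Frechet_Urysohn_space :: "'a topology \<Rightarrow> bool" where
  "Frechet_Urysohn_space X \<longleftrightarrow>
     (\<forall>A a. A \<subseteq> topspace X \<and> a \<in> X closure_of A \<longrightarrow>
        (\<exists>s :: nat \<Rightarrow> 'a. range s \<subseteq> A \<and> limitin X s a sequentially))"

text \<open>
  A formula cannot quantify over types, so the test spaces \<open>X\<close> in assertions (ii) and (iii) of the
  theorem are the topologies whose points belong to a type \<open>'b\<close>, which is left arbitrary.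
  The implications (i) to (ii) and (ii) to (iii) hold for every \<open>'b\<close>. The implication from (iii)
  back to (i) fails if \<open>'b\<close> has too few elements (for instance, if all test spaces have at most one
  point), so there \<open>'b\<close> is assumed to be at least as large as the power set of the type of the
  points of \<open>Y\<close>. For every such \<open>'b\<close> the three assertions are equivalent.
\<close>

end

theory Submission
  imports Defs
begin

text \<open>
  (i) to (ii): let \<open>f\<close> be \<open>k\<close>-continuous on the product. For compact \<open>K\<close> in \<open>X\<close>, the functions
  \<open>f (x, _)\<close> with \<open>x \<in> K\<close> are equicontinuous on compact sets of \<open>Y\<close>, hence on \<open>Y\<close>, since the
  pseudometric they induce is continuous by the \<open>k\<^sub>R\<close>-property. A pseudocompact neighbourhood
  \<open>N\<close> is totally bounded for this pseudometric, so the functions \<open>f (_, y)\<close> with \<open>y \<in> N\<close>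
  are equicontinuous on \<open>K\<close>; since \<open>K\<close> is arbitrary and \<open>X\<close> is a \<open>k\<^sub>R\<close>-space, they are
  equicontinuous on \<open>X\<close>, and \<open>f\<close> is continuous.

  (iii) to (i): if no neighbourhood of \<open>y0\<close> is pseudocompact, every open \<open>U\<close> containing \<open>y0\<close>
  carries a locally finite sequence of bump functions. Take for \<open>X\<close> the sequential fan with one
  sequence for every \<open>U\<close>, and let \<open>f (x, y)\<close> be the value at \<open>y\<close> of the \<open>n\<close>-th bump in \<open>U\<close> if
  \<open>x\<close> is the \<open>n\<close>-th point of the sequence of \<open>U\<close>. A compact subset of the fan meets only
  finitely many sequences, which makes \<open>f\<close> \<open>k\<close>-continuous, but \<open>f\<close> is discontinuous at the
  vertex paired with \<open>y0\<close>.
\<close>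

section \<open>Equicontinuity and products with locally pseudocompact spaces\<close>

lemma continuous_map_real_iff:
  "continuous_map X euclideanreal f \<longleftrightarrow>
    (\<forall>x\<in>topspace X. \<forall>e>0. \<exists>U. openin X U \<and> x \<in> U \<and> (\<forall>z\<in>U. \<bar>f z - f x\<bar> < e))"
  using Met_TC.continuous_map_to_metric[of X f]
  by (simp add: dist_real_def abs_minus_commute)

section \<open>Equicontinuity expressed through a supremum pseudometric\<close>

definition equicontinuous_family :: "'a topology \<Rightarrow> 'i set \<Rightarrow> ('i \<Rightarrow> 'a \<Rightarrow> real) \<Rightarrow> bool" where
  "equicontinuous_family X I F \<longleftrightarrow>
    (\<forall>x\<in>topspace X. \<forall>e>0. \<exists>U. openin X U \<and> x \<in> U \<and> (\<forall>z\<in>U. \<forall>i\<in>I. \<bar>F i z - F i x\<bar> < e))"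

text \<open>Truncation at 1 keeps the supremum finite for unbounded families; inserting 0 covers
  the empty index set.\<close>

definition sup_dist :: "'i set \<Rightarrow> ('i \<Rightarrow> 'a \<Rightarrow> real) \<Rightarrow> 'a \<Rightarrow> 'a \<Rightarrow> real" where
  "sup_dist I F x y = Sup (insert 0 ((\<lambda>i. min 1 \<bar>F i x - F i y\<bar>) ` I))"

lemma bdd_above_sup_dist: "bdd_above (insert 0 ((\<lambda>i. min 1 \<bar>F i x - F i y :: real\<bar>) ` I))"
  by (rule bdd_aboveI[of _ 1]) auto

lemma sup_dist_upper: "i \<in> I \<Longrightarrow> min 1 \<bar>F i x - F i y\<bar> \<le> sup_dist I F x y"
  unfolding sup_dist_def by (intro cSup_upper bdd_above_sup_dist) auto

lemma sup_dist_nonneg: "0 \<le> sup_dist I F x y"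
  unfolding sup_dist_def by (intro cSup_upper bdd_above_sup_dist) auto

lemma sup_dist_least:
  "0 \<le> c \<Longrightarrow> (\<And>i. i \<in> I \<Longrightarrow> min 1 \<bar>F i x - F i y\<bar> \<le> c) \<Longrightarrow> sup_dist I F x y \<le> c"
  unfolding sup_dist_def by (intro cSup_least) auto

lemma sup_dist_refl [simp]: "sup_dist I F x x = 0"
  by (intro antisym sup_dist_nonneg sup_dist_least) auto

lemma sup_dist_commute: "sup_dist I F x y = sup_dist I F y x"
  unfolding sup_dist_def by (simp add: abs_minus_commute)

lemma sup_dist_triangle: "sup_dist I F x z \<le> sup_dist I F x y + sup_dist I F y z"
proof (rule sup_dist_least)
  fix i assume "i \<in> I"
  then have "min 1 \<bar>F i x - F i y\<bar> \<le> sup_dist I F x y" "min 1 \<bar>F i y - F i z\<bar> \<le> sup_dist I F y z"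
    by (simp_all only: sup_dist_upper)
  then show "min 1 \<bar>F i x - F i z\<bar> \<le> sup_dist I F x y + sup_dist I F y z"
    by linarith
qed (simp add: sup_dist_nonneg)

text \<open>Below the truncation level 1, the supremum controls the untruncated differences; hence
  the bound \<open>e \<le> 1\<close>.\<close>

lemma sup_dist_lessD:
  assumes "sup_dist I F x y < e" "e \<le> 1" "i \<in> I"
  shows "\<bar>F i x - F i y\<bar> < e"
  using sup_dist_upper[OF assms(3), of F x y] assms(1,2) by linarith

text \<open>A bound \<open>e/2\<close> uniform in the index survives the supremum as a non-strict
  bound, and the triangle inequality transfers it to distances from \<open>x0\<close>.\<close>

lemma equicontinuous_imp_continuous_sup_dist:
  assumes "equicontinuous_family X I F"
  shows "continuous_map X euclideanreal (sup_dist I F x0)"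
  unfolding continuous_map_real_iff
proof (intro ballI allI impI)
  fix x and e :: real
  assume x: "x \<in> topspace X" and e: "0 < e"
  then obtain U where U: "openin X U" "x \<in> U" "\<And>z i. z \<in> U \<Longrightarrow> i \<in> I \<Longrightarrow> \<bar>F i z - F i x\<bar> < e/2"
    using assms unfolding equicontinuous_family_def by (meson half_gt_zero)
  have "\<bar>sup_dist I F x0 z - sup_dist I F x0 x\<bar> < e" if z: "z \<in> U" for z
  proof -
    have "sup_dist I F z x \<le> e/2"
    proof (rule sup_dist_least)
      fix i assume "i \<in> I"
      then show "min 1 \<bar>F i z - F i x\<bar> \<le> e/2" using U(3)[OF z, of i] by (intro min.coboundedI2) simp
    qed (use e in simp)
    then show ?thesis
      using sup_dist_triangle[of I F x0 z x] sup_dist_triangle[of I F x0 x z]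
        sup_dist_commute[of I F x z] e by linarith
  qed
  with U show "\<exists>U. openin X U \<and> x \<in> U \<and> (\<forall>z\<in>U. \<bar>sup_dist I F x0 z - sup_dist I F x0 x\<bar> < e)"
    by blast
qed

text \<open>Only continuity of the distance from \<open>x\<close> at \<open>x\<close> itself is
  used, where its value is 0.\<close>

lemma continuous_sup_dist_imp_equicontinuous:
  assumes "\<And>x. x \<in> topspace X \<Longrightarrow> continuous_map X euclideanreal (sup_dist I F x)"
  shows "equicontinuous_family X I F"
  unfolding equicontinuous_family_def
proof (intro ballI allI impI)
  fix x and e :: real
  assume x: "x \<in> topspace X" and e: "0 < e"
  then obtain U where U: "openin X U" "x \<in> U" "\<And>z. z \<in> U \<Longrightarrow> \<bar>sup_dist I F x z - sup_dist I F x x\<bar> < min 1 e"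
  proof -
    \<comment> \<open>A radius of at most 1 makes the truncation invisible.\<close>
    have "0 < min 1 e" using e by simp
    with assms[OF x] x that show thesis unfolding continuous_map_real_iff by blast
  qed
  have "\<bar>F i z - F i x\<bar> < e" if "z \<in> U" "i \<in> I" for z i
  proof -
    have "sup_dist I F x z < min 1 e" using U(3)[OF \<open>z \<in> U\<close>] by (auto simp: abs_less_iff)
    from sup_dist_lessD[OF this _ \<open>i \<in> I\<close>] show ?thesis by (simp add: abs_minus_commute)
  qed
  with U show "\<exists>U. openin X U \<and> x \<in> U \<and> (\<forall>z\<in>U. \<forall>i\<in>I. \<bar>F i z - F i x\<bar> < e)"
    by blast
qed

text \<open>The pseudometric encodes equicontinuity as continuity of the single real functions
  \<open>sup_dist I F x\<close>, to which the \<open>k\<^sub>R\<close>-property applies.\<close>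

lemma kR_space_equicontinuous:
  assumes "kR_space X" "\<And>K. compactin X K \<Longrightarrow> equicontinuous_family (subtopology X K) I F"
  shows "equicontinuous_family X I F"
proof (rule continuous_sup_dist_imp_equicontinuous)
  fix x
  have "k_continuous X (sup_dist I F x)"
    unfolding k_continuous_def
    by (intro allI impI equicontinuous_imp_continuous_sup_dist assms(2))
  with assms(1) show "continuous_map X euclideanreal (sup_dist I F x)"
    unfolding kR_space_def by simp
qed

section \<open>Compact and pseudocompact index sets\<close>

text \<open>A tube argument: finitely many boxes on which \<open>f\<close> varies little cover the
  compact slice at height \<open>y\<close>, and their second sides are intersected.\<close>

lemma compact_equicontinuous:
  assumes K: "compact_space K" and f: "continuous_map (prod_topology K Z) euclideanreal f"
  shows "equicontinuous_family Z (topspace K) (\<lambda>x y. f (x, y))"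
  unfolding equicontinuous_family_def
proof (intro ballI allI impI)
  fix y and e :: real
  assume y: "y \<in> topspace Z" and e: "0 < e"
  have "\<exists>U W. openin K U \<and> openin Z W \<and> x \<in> U \<and> y \<in> W \<and>
      (\<forall>x'\<in>U. \<forall>z\<in>W. \<bar>f (x', z) - f (x, y)\<bar> < e/2)" if x: "x \<in> topspace K" for x
  proof -
    have "(x, y) \<in> topspace (prod_topology K Z)"
      using x y by simp
    then obtain S where S: "openin (prod_topology K Z) S" "(x, y) \<in> S"
      "\<And>p. p \<in> S \<Longrightarrow> \<bar>f p - f (x, y)\<bar> < e/2"
      using f e unfolding continuous_map_real_iff by (meson half_gt_zero)
    from S(1,2) obtain U W where "openin K U" "openin Z W" "x \<in> U" "y \<in> W" "U \<times> W \<subseteq> S"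
      unfolding openin_prod_topology_alt by metis
    with S(3) show ?thesis by blast
  qed
  then obtain U W where UW: "\<And>x. x \<in> topspace K \<Longrightarrow> openin K (U x) \<and> openin Z (W x) \<and> x \<in> U x \<and> y \<in> W x \<and>
      (\<forall>x'\<in>U x. \<forall>z\<in>W x. \<bar>f (x', z) - f (x, y)\<bar> < e/2)"
    by metis
  have "\<forall>V\<in>U ` topspace K. openin K V" "topspace K \<subseteq> \<Union>(U ` topspace K)"
    using UW by auto
  with K obtain \<F> where "finite \<F>" "\<F> \<subseteq> U ` topspace K" "topspace K \<subseteq> \<Union>\<F>"
    unfolding compact_space_alt by meson
  then obtain T where T: "finite T" "T \<subseteq> topspace K" "topspace K \<subseteq> \<Union>(U ` T)"
    using finite_subset_image by metis
  \<comment> \<open>The factor \<open>topspace Z\<close> keeps this set inside the space when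
    \<open>T\<close> is empty.\<close>
  let ?W = "topspace Z \<inter> \<Inter>(W ` T)"
  have "openin Z ?W"
    using T UW by (subst Int_commute) (auto intro!: openin_INT)
  moreover have "y \<in> ?W" using y T UW by auto
  moreover have "\<bar>f (x, z) - f (x, y)\<bar> < e" if z: "z \<in> ?W" and x: "x \<in> topspace K" for z x
  proof -
    obtain t where t: "t \<in> T" "x \<in> U t" using T x by blast
    then have "t \<in> topspace K" "z \<in> W t" using T z by auto
    then have "\<bar>f (x, z) - f (t, y)\<bar> < e/2" "\<bar>f (x, y) - f (t, y)\<bar> < e/2"
      using UW[of t] t by auto
    then show ?thesis by linarith
  qed
  ultimately show "\<exists>W. openin Z W \<and> y \<in> W \<and> (\<forall>z\<in>W. \<forall>i\<in>topspace K. \<bar>f (i, z) - f (i, y)\<bar> < e)"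
    by blast
qed

text \<open>The reciprocal of \<open>h\<close> is continuous, hence bounded.\<close>

lemma pseudocompact_positive_lower_bound:
  assumes "pseudocompact_space N" and h: "continuous_map N euclideanreal h"
    and pos: "\<And>y. y \<in> topspace N \<Longrightarrow> 0 < h y"
  obtains c where "0 < c" "\<And>y. y \<in> topspace N \<Longrightarrow> c \<le> h y"
proof -
  have "continuous_map N euclideanreal (\<lambda>y. inverse (h y))"
    using h pos by (intro continuous_map_real_inverse) (auto simp: less_le)
  then have "bounded ((\<lambda>y. inverse (h y)) ` topspace N)"
    using assms(1) unfolding pseudocompact_space_def by blast
  then obtain B where B: "B > 0" "\<And>y. y \<in> topspace N \<Longrightarrow> \<bar>inverse (h y)\<bar> \<le> B"
    unfolding bounded_pos by auto
  have "inverse B \<le> h y" if "y \<in> topspace N" for y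
    using B(2)[OF that] pos[OF that] B(1) by (metis abs_of_pos inverse_inverse_eq inverse_le_imp_le inverse_positive_iff_positive)
  with B(1) that[of "inverse B"] show thesis by simp
qed

text \<open>An infinite \<open>e\<close>-separated sequence \<open>s\<close> would make
  \<open>INF n. sup_dist I F (s n) y + 1 / (n + 1)\<close> a positive continuous function of \<open>y\<close> with
  infimum 0.\<close>

lemma pseudocompact_totally_bounded:
  assumes N: "pseudocompact_space N" and F: "equicontinuous_family N I F" and e: "0 < e"
  obtains T where "finite T" "T \<subseteq> topspace N"
    "\<And>y. y \<in> topspace N \<Longrightarrow> \<exists>t\<in>T. sup_dist I F t y < e"
proof (rule ccontr)
  assume nt: "\<not> thesis"
  let ?d = "sup_dist I F"
  have far: "\<exists>y\<in>topspace N. \<forall>t\<in>T. e \<le> ?d t y" if "finite T" "T \<subseteq> topspace N" for T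
    using nt that \<open>\<And>T. finite T \<Longrightarrow> T \<subseteq> topspace N \<Longrightarrow>
      (\<And>y. y \<in> topspace N \<Longrightarrow> \<exists>t\<in>T. ?d t y < e) \<Longrightarrow> thesis\<close> by (meson not_le)
  \<comment> \<open>Greedy choice: the finitely many earlier points never form an
    \<open>e\<close>-net.\<close>
  have "\<exists>s. \<forall>n::nat. s n \<in> topspace N \<and> (\<forall>m<n. e \<le> ?d (s m) (s n))"
  proof (rule dependent_wellorder_choice)
    fix n :: nat and s :: "nat \<Rightarrow> 'a"
    assume "\<And>m. m < n \<Longrightarrow> s m \<in> topspace N \<and> (\<forall>k<m. e \<le> ?d (s k) (s m))"
    then have "s ` {..<n} \<subseteq> topspace N" by auto
    with far[of "s ` {..<n}"] show "\<exists>y. y \<in> topspace N \<and> (\<forall>m<n. e \<le> ?d (s m) y)"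
      by auto
  qed auto
  then obtain s where "\<forall>n::nat. s n \<in> topspace N \<and> (\<forall>m<n. e \<le> ?d (s m) (s n))" ..
  then have s: "\<And>n. s n \<in> topspace N" "\<And>m n. m < n \<Longrightarrow> e \<le> ?d (s m) (s n)"
    by simp_all
  have sep: "e \<le> ?d (s m) (s n)" if "m \<noteq> n" for m n
    using s(2)[of m n] s(2)[of n m] that sup_dist_commute[of I F "s m" "s n"] by fastforce
  define g where "g n y = ?d (s n) y + 1 / real (Suc n)" for n y
  define h where "h y = (INF n. g n y)" for y
  have bdd: "bdd_below (range (\<lambda>n. g n y))" for y
    by (rule bdd_belowI[of _ 0]) (auto simp: g_def intro!: add_nonneg_nonneg sup_dist_nonneg)
  have h_le: "h y \<le> g n y" for n y
    unfolding h_def by (rule cINF_lower[OF bdd]) simp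
  \<comment> \<open>Each \<open>g n\<close> is 1-Lipschitz for the pseudometric, so their infimum is
    too; this makes \<open>h\<close> continuous.\<close>
  have lip: "h y \<le> h z + ?d z y" for y z
  proof -
    have "h y - ?d z y \<le> g n z" for n
      using h_le[of y n] sup_dist_triangle[of I F "s n" y z] unfolding g_def by linarith
    then have "h y - ?d z y \<le> h z"
      unfolding h_def by (intro cINF_greatest) auto
    then show ?thesis by simp
  qed
  have "continuous_map N euclideanreal h"
    unfolding continuous_map_real_iff
  proof (intro ballI allI impI)
    fix x and r :: real
    assume x: "x \<in> topspace N" and r: "0 < r"
    then obtain U where U: "openin N U" "x \<in> U" "\<And>z. z \<in> U \<Longrightarrow> \<bar>?d x z - ?d x x\<bar> < r"
      using equicontinuous_imp_continuous_sup_dist[OF F, of x]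
      unfolding continuous_map_real_iff by meson
    have "\<bar>h z - h x\<bar> < r" if "z \<in> U" for z
      using U(3)[OF that] lip[of z x] lip[of x z] sup_dist_commute[of I F x z] by simp
    with U show "\<exists>U. openin N U \<and> x \<in> U \<and> (\<forall>z\<in>U. \<bar>h z - h x\<bar> < r)"
      by blast
  qed
  moreover have "0 < h y" for y
  proof -
    \<comment> \<open>By separation at most one \<open>s k\<close> lies within \<open>e/2\<close> of
      \<open>y\<close>. The other terms of the infimum are at least \<open>e/2\<close>, and the
      \<open>k\<close>-th is at least \<open>1 / (k + 1)\<close>.\<close>
    obtain k where k: "\<And>n. n \<noteq> k \<Longrightarrow> e/2 \<le> ?d (s n) y"
    proof (cases "\<exists>k. ?d (s k) y < e/2")
      case True
      then obtain k where k: "?d (s k) y < e/2" by blast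
      have "e/2 \<le> ?d (s n) y" if "n \<noteq> k" for n
        using sep[OF that] sup_dist_triangle[of I F "s n" "s k" y] sup_dist_commute[of I F "s k" y] k
        by linarith
      then show thesis using that by blast
    next
      case False
      then show thesis using that by (meson not_le)
    qed
    have "min (e/2) (1 / real (Suc k)) \<le> g n y" for n
    proof (cases "n = k")
      case True
      then show ?thesis
        using sup_dist_nonneg[of I F "s k" y] unfolding g_def by (intro min.coboundedI2) simp
    next
      case False
      have "0 \<le> 1 / real (Suc n)" by simp
      with k[OF False] show ?thesis unfolding g_def by linarith
    qed
    then have "min (e/2) (1 / real (Suc k)) \<le> h y"
      unfolding h_def by (intro cINF_greatest) auto
    moreover have "0 < min (e/2) (1 / real (Suc k))" using e by simp
    ultimately show ?thesis by linarith
  qed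
  ultimately obtain c where c: "0 < c" "\<And>y. y \<in> topspace N \<Longrightarrow> c \<le> h y"
    using pseudocompact_positive_lower_bound[OF N] by metis
  obtain n where "1 / real (Suc n) < c"
    using c(1) reals_Archimedean by (metis inverse_eq_divide)
  \<comment> \<open>At \<open>s n\<close> the distance term of \<open>g n\<close> vanishes.\<close>
  moreover have "c \<le> 1 / real (Suc n)"
    using c(2)[OF s(1), of n] h_le[of "s n" n] unfolding g_def by simp
  ultimately show False by linarith
qed

text \<open>Points and indices change roles: a finite net \<open>T\<close> in \<open>N\<close>
  reduces the family over \<open>N\<close> to finitely many functions continuous at
  \<open>x\<close>, and every other \<open>y\<close> is compared with a net point at both
  \<open>z\<close> and \<open>x\<close>.\<close>

lemma equicontinuous_transpose:
  assumes N: "pseudocompact_space N"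
    and F: "equicontinuous_family N I F" and I: "topspace K \<subseteq> I"
    and cont: "\<And>y. y \<in> topspace N \<Longrightarrow> continuous_map K euclideanreal (\<lambda>x. F x y)"
  shows "equicontinuous_family K (topspace N) (\<lambda>y x. F x y)"
  unfolding equicontinuous_family_def
proof (intro ballI allI impI)
  fix x and e :: real
  assume x: "x \<in> topspace K" and e: "0 < e"
  \<comment> \<open>The estimate has three terms, and \<open>sup_dist_lessD\<close> asks for a
    radius of at most 1.\<close>
  define r where "r = min 1 (e/3)"
  have r: "0 < r" "r \<le> 1" "3 * r \<le> e" using e by (auto simp: r_def)
  obtain T where T: "finite T" "T \<subseteq> topspace N"
    "\<And>y. y \<in> topspace N \<Longrightarrow> \<exists>t\<in>T. sup_dist I F t y < r"
    using pseudocompact_totally_bounded[OF N F r(1)] by metis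
  have "\<exists>U. openin K U \<and> x \<in> U \<and> (\<forall>z\<in>U. \<bar>F z t - F x t\<bar> < r)" if "t \<in> T" for t
    using cont[of t] that T(2) x r(1) unfolding continuous_map_real_iff by blast
  then obtain U where U: "\<And>t. t \<in> T \<Longrightarrow> openin K (U t) \<and> x \<in> U t \<and> (\<forall>z\<in>U t. \<bar>F z t - F x t\<bar> < r)"
    by metis
  let ?U = "topspace K \<inter> \<Inter>(U ` T)"
  have "openin K ?U"
    using T U by (subst Int_commute) (auto intro!: openin_INT)
  moreover have "x \<in> ?U" using x U by auto
  moreover have "\<bar>F z y - F x y\<bar> < e" if z: "z \<in> ?U" and y: "y \<in> topspace N" for z y
  proof -
    obtain t where t: "t \<in> T" "sup_dist I F t y < r" using T y by blast
    then have "\<bar>F z t - F z y\<bar> < r" "\<bar>F x t - F x y\<bar> < r"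
      using sup_dist_lessD[OF t(2) r(2)] z x I by blast+
    moreover have "\<bar>F z t - F x t\<bar> < r" using U[OF t(1)] z t(1) by auto
    ultimately show ?thesis using r(3) by linarith
  qed
  ultimately show "\<exists>U. openin K U \<and> x \<in> U \<and> (\<forall>z\<in>U. \<forall>y\<in>topspace N. \<bar>F z y - F x y\<bar> < e)"
    by blast
qed

section \<open>The product theorem\<close>

lemma kR_space_prod:
  assumes X: "kR_space X" and Y: "kR_space Y" and lpY: "locally_pseudocompact_space Y"
  shows "kR_space (prod_topology X Y)"
  unfolding kR_space_def
proof (intro allI impI)
  fix f :: "'a \<times> 'b \<Rightarrow> real"
  assume f: "k_continuous (prod_topology X Y) f"
  have cK: "continuous_map (prod_topology (subtopology X K) (subtopology Y L)) euclideanreal f"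
    if "compactin X K" "compactin Y L" for K L
    using f that unfolding k_continuous_def subtopology_Times[symmetric]
    by (simp add: compactin_Times)
  have eqY: "equicontinuous_family Y K (\<lambda>x y. f (x, y))" if K: "compactin X K" for K
  proof (rule kR_space_equicontinuous[OF Y])
    fix L assume "compactin Y L"
    then show "equicontinuous_family (subtopology Y L) K (\<lambda>x y. f (x, y))"
      using compact_equicontinuous[OF _ cK[OF K]] K compactin_subset_topspace[OF K]
      by (simp add: compact_space_subtopology Int_absorb1)
  qed
  \<comment> \<open>Horizontal slices: the compact set \<open>{y}\<close> serves as second factor in
    \<open>cK\<close>.\<close>
  have cX: "continuous_map (subtopology X K) euclideanreal (\<lambda>x. f (x, y))"
    if K: "compactin X K" and y: "y \<in> topspace Y" for K y
  proof -
    have "continuous_map (subtopology X K) (prod_topology (subtopology X K) (subtopology Y {y})) (\<lambda>x. (x, y))"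
      using y by (auto intro!: continuous_map_pairedI)
    from continuous_map_compose[OF this cK[OF K]] y show ?thesis
      by (simp add: o_def)
  qed
  show "continuous_map (prod_topology X Y) euclideanreal f"
    unfolding continuous_map_real_iff
  proof (intro ballI allI impI)
    fix p and e :: real
    assume "p \<in> topspace (prod_topology X Y)" and e: "0 < e"
    then obtain x y where p: "p = (x, y)" and x: "x \<in> topspace X" and y: "y \<in> topspace Y"
      by auto
    obtain V N where V: "openin Y V" "y \<in> V" "V \<subseteq> N" "N \<subseteq> topspace Y"
      and N: "pseudocompact_space (subtopology Y N)"
      using lpY y unfolding locally_pseudocompact_space_def by meson
    have N_eq: "topspace (subtopology Y N) = N" using V(4) by (simp add: Int_absorb1)
    have "equicontinuous_family X N (\<lambda>y x. f (x, y))"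
    proof (rule kR_space_equicontinuous[OF X])
      fix K assume K: "compactin X K"
      \<comment> \<open>Equicontinuity on \<open>Y\<close> restricts to \<open>N\<close>, where it
        can be transposed.\<close>
      have "equicontinuous_family (subtopology Y N) K (\<lambda>x y. f (x, y))"
        unfolding equicontinuous_family_def N_eq
      proof (intro ballI allI impI)
        fix z and r :: real
        assume z: "z \<in> N" and r: "0 < r"
        then have "z \<in> topspace Y" using V(4) by blast
        with r obtain W where W: "openin Y W" "z \<in> W" "\<forall>w\<in>W. \<forall>i\<in>K. \<bar>f (i, w) - f (i, z)\<bar> < r"
          using eqY[OF K] unfolding equicontinuous_family_def by meson
        then have "openin (subtopology Y N) (W \<inter> N)"
          by (auto simp: openin_subtopology)
        with W z show "\<exists>U. openin (subtopology Y N) U \<and> z \<in> U \<and> (\<forall>w\<in>U. \<forall>i\<in>K. \<bar>f (i, w) - f (i, z)\<bar> < r)"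
          by (intro exI[of _ "W \<inter> N"]) simp
      qed
      from equicontinuous_transpose[OF N this _ cX[OF K]] V(4)
      show "equicontinuous_family (subtopology X K) N (\<lambda>y x. f (x, y))"
        unfolding N_eq by auto
    qed
    then obtain U where U: "openin X U" "x \<in> U" "\<And>z w. z \<in> U \<Longrightarrow> w \<in> N \<Longrightarrow> \<bar>f (z, w) - f (x, w)\<bar> < e/2"
      using x e unfolding equicontinuous_family_def by (meson half_gt_zero)
    \<comment> \<open>The compact set \<open>{x}\<close> yields continuity of the vertical slice
      through \<open>x\<close>.\<close>
    have "equicontinuous_family Y {x} (\<lambda>x y. f (x, y))"
      using eqY[of "{x}"] x by simp
    then obtain W where W: "openin Y W" "y \<in> W" "\<And>w. w \<in> W \<Longrightarrow> \<bar>f (x, w) - f (x, y)\<bar> < e/2"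
      using y e unfolding equicontinuous_family_def by (meson half_gt_zero singletonI)
    \<comment> \<open>On this box the first coordinate moves first, uniformly in \<open>w\<close>
      because \<open>V \<subseteq> N\<close>; then the second moves along the slice at
      \<open>x\<close>.\<close>
    have "openin (prod_topology X Y) (U \<times> (V \<inter> W))"
      using U V W by (simp add: openin_prod_Times_iff openin_Int)
    moreover have "p \<in> U \<times> (V \<inter> W)" using p U V W by auto
    moreover have "\<bar>f q - f p\<bar> < e" if q: "q \<in> U \<times> (V \<inter> W)" for q
    proof -
      obtain z w where zw: "q = (z, w)" "z \<in> U" "w \<in> V" "w \<in> W" using q by auto
      have "\<bar>f (z, w) - f (x, w)\<bar> < e/2" using U(3) zw V(3) by blast
      moreover have "\<bar>f (x, w) - f (x, y)\<bar> < e/2" using W(3) zw by blast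
      ultimately have "\<bar>f (z, w) - f (x, y)\<bar> < e" by linarith
      then show ?thesis using zw p by simp
    qed
    ultimately show "\<exists>U. openin (prod_topology X Y) U \<and> p \<in> U \<and> (\<forall>q\<in>U. \<bar>f q - f p\<bar> < e)"
      by blast
  qed
qed

section \<open>Passing to a factor, and Frechet-Urysohn spaces\<close>

text \<open>Compact sets project to compact sets, so \<open>f \<circ> snd\<close> is
  \<open>k\<close>-continuous; its continuity is then restricted to the slice over a point
  \<open>a\<close>.\<close>

lemma kR_space_prodD:
  assumes "kR_space (prod_topology X Y)" "topspace X \<noteq> {}"
  shows "kR_space Y"
  unfolding kR_space_def
proof (intro allI impI)
  fix f assume f: "k_continuous Y f"
  obtain a where a: "a \<in> topspace X" using assms(2) by blast
  have "k_continuous (prod_topology X Y) (f \<circ> snd)"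
    unfolding k_continuous_def
  proof (intro allI impI)
    fix K assume K: "compactin (prod_topology X Y) K"
    then have "compactin Y (snd ` K)"
      by (rule image_compactin) (rule continuous_map_snd)
    with f have "continuous_map (subtopology Y (snd ` K)) euclideanreal f"
      unfolding k_continuous_def by blast
    moreover have "continuous_map (subtopology (prod_topology X Y) K) (subtopology Y (snd ` K)) snd"
      by (auto simp: continuous_map_in_subtopology intro: continuous_map_from_subtopology continuous_map_snd)
    ultimately show "continuous_map (subtopology (prod_topology X Y) K) euclideanreal (f \<circ> snd)"
      by (rule continuous_map_compose[rotated])
  qed
  with assms(1) have "continuous_map (prod_topology X Y) euclideanreal (f \<circ> snd)"
    unfolding kR_space_def by blast
  moreover have "continuous_map Y (prod_topology X Y) (\<lambda>y. (a, y))"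
    using a by (auto intro!: continuous_map_pairedI)
  ultimately have "continuous_map Y euclideanreal ((f \<circ> snd) \<circ> (\<lambda>y. (a, y)))"
    by (rule continuous_map_compose[rotated])
  then show "continuous_map Y euclideanreal f" by (simp add: o_def)
qed

text \<open>A convergent sequence together with its limit is compact, so a
  \<open>k\<close>-continuous function is sequentially continuous; a discontinuity at
  \<open>x\<close> would put \<open>x\<close> in the closure of the set \<open>A\<close> of points
  with values far from \<open>f x\<close>.\<close>

lemma Frechet_Urysohn_imp_kR_space:
  assumes X: "Frechet_Urysohn_space X"
  shows "kR_space X"
  unfolding kR_space_def continuous_map_real_iff
proof (intro allI impI ballI)
  fix f x and e :: real
  assume f: "k_continuous X f" and x: "x \<in> topspace X" and e: "0 < e"
  define A where "A = {z \<in> topspace X. e \<le> \<bar>f z - f x\<bar>}"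
  have "x \<notin> X closure_of A"
  proof
    assume "x \<in> X closure_of A"
    moreover have "A \<subseteq> topspace X" by (auto simp: A_def)
    ultimately obtain s :: "nat \<Rightarrow> 'a" where s: "range s \<subseteq> A" "limitin X s x sequentially"
      using X unfolding Frechet_Urysohn_space_def by blast
    have K: "compactin X (insert x (range s))"
      using s A_def by (intro compactin_sequence_with_limit) auto
    with f have "continuous_map (subtopology X (insert x (range s))) euclideanreal f"
      unfolding k_continuous_def by blast
    moreover have "limitin (subtopology X (insert x (range s))) s x sequentially"
      using s by (auto simp: limitin_subtopology)
    ultimately have "limitin euclideanreal (f \<circ> s) (f x) sequentially"
      by (rule continuous_map_limit)
    then obtain n where "dist (f (s n)) (f x) < e"
      using e by (auto simp: tendsto_iff eventually_sequentially)
    moreover have "s n \<in> A" using s by blast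
    ultimately show False by (simp add: A_def dist_real_def)
  qed
  then obtain U where "openin X U" "x \<in> U" "\<And>z. z \<in> U \<Longrightarrow> z \<notin> A"
    using x unfolding in_closure_of by blast
  moreover from this(1) have "U \<subseteq> topspace X" by (rule openin_subset)
  ultimately show "\<exists>U. openin X U \<and> x \<in> U \<and> (\<forall>z\<in>U. \<bar>f z - f x\<bar> < e)"
    unfolding A_def by (metis (mono_tags, lifting) mem_Collect_eq not_le subsetD)
qed

section \<open>The sequential fan\<close>

text \<open>A continuous function unbounded on the closure is already unbounded on the dense part
  \<open>U\<close>. Keeping it defined on the closure later gives local finiteness at boundary
  points of \<open>U\<close>.\<close>

lemma pseudocompact_space_dense:
  assumes U: "U \<subseteq> topspace Y" and "\<not> pseudocompact_space (subtopology Y (Y closure_of U))"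
  obtains g where "continuous_map (subtopology Y (Y closure_of U)) euclideanreal g"
    "\<And>n::nat. \<exists>y\<in>U. real n < \<bar>g y\<bar>"
proof -
  let ?C = "subtopology Y (Y closure_of U)"
  have tC: "topspace ?C = Y closure_of U"
    by (simp add: Int_absorb1 closure_of_subset_topspace)
  obtain g where g: "continuous_map ?C euclideanreal g" and unb: "\<not> bounded (g ` (Y closure_of U))"
    using assms(2) unfolding pseudocompact_space_def tC by blast
  have "\<exists>y\<in>U. real n < \<bar>g y\<bar>" for n
  proof -
    \<comment> \<open>The surplus 1 pays for replacing \<open>z\<close> by a nearby point of
      \<open>U\<close>.\<close>
    obtain z where z: "z \<in> Y closure_of U" "real n + 1 < \<bar>g z\<bar>"
      using unb unfolding bounded_iff by (auto simp: not_le)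
    then obtain W where W: "openin ?C W" "z \<in> W" "\<And>w. w \<in> W \<Longrightarrow> \<bar>g w - g z\<bar> < 1"
      using g unfolding continuous_map_real_iff tC by (meson zero_less_one)
    obtain T where T: "openin Y T" "W = T \<inter> Y closure_of U"
      using W(1) unfolding openin_subtopology by blast
    then obtain y where "y \<in> U" "y \<in> T"
      using z W(2) unfolding in_closure_of by blast
    moreover have "y \<in> W"
      using calculation T closure_of_subset[OF U] by blast
    ultimately show ?thesis using W(3)[of y] z(2) by (intro bexI[of _ y]) linarith+
  qed
  with g show thesis using that by blast
qed

text \<open>The \<open>n\<close>-th bump lives where \<open>\<bar>g\<bar>\<close> exceeds
  \<open>n\<close> inside \<open>U\<close>. Since \<open>g\<close> is locally bounded on the
  closure, the bumps are locally finite there; off the closure they all vanish.\<close>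

lemma nonpseudocompact_bumps:
  assumes Y: "completely_regular_space Y" and U: "openin Y U"
    and npc: "\<not> pseudocompact_space (subtopology Y (Y closure_of U))"
  obtains \<phi> :: "nat \<Rightarrow> 'a \<Rightarrow> real" where "\<And>n. continuous_map Y euclideanreal (\<phi> n)"
    "\<And>n. \<exists>y\<in>U. \<phi> n y = 1"
    "\<And>y. y \<in> topspace Y \<Longrightarrow> \<exists>W N. openin Y W \<and> y \<in> W \<and> (\<forall>n\<ge>N. \<forall>z\<in>W. \<phi> n z = 0)"
proof -
  let ?C = "subtopology Y (Y closure_of U)"
  have UY: "U \<subseteq> topspace Y" using U by (rule openin_subset)
  have UC: "U \<subseteq> Y closure_of U" using UY by (rule closure_of_subset)
  have tC: "topspace ?C = Y closure_of U"
    by (simp add: Int_absorb1 closure_of_subset_topspace)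
  obtain g where g: "continuous_map ?C euclideanreal g" and unb: "\<And>n::nat. \<exists>y\<in>U. real n < \<bar>g y\<bar>"
    using pseudocompact_space_dense[OF UY npc] by metis
  define V where "V n = {y \<in> U. real n < \<bar>g y\<bar>}" for n
  have V_open: "openin Y (V n)" for n
  proof -
    have "continuous_map (subtopology Y U) euclideanreal g"
      using g UC by (rule continuous_map_from_subtopology_mono)
    then have "continuous_map (subtopology Y U) euclideanreal (\<lambda>y. \<bar>g y\<bar>)"
      by (rule continuous_map_real_abs)
    from openin_continuous_map_preimage[OF this, of "{real n<..}"]
    have "openin (subtopology Y U) (V n)"
      using UY by (simp add: V_def Int_absorb1)
    then show ?thesis using U openin_trans_full by blast
  qed
  have "\<exists>f. continuous_map Y euclideanreal f \<and> (\<exists>y\<in>U. f y = 1) \<and> (\<forall>y\<in>topspace Y - V n. f y = 0)" for n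
  proof -
    obtain y where y: "y \<in> U" "y \<in> V n" using unb[of n] by (auto simp: V_def)
    then obtain f where "continuous_map Y euclideanreal f" "f y = 0" "f ` (topspace Y - V n) \<subseteq> {1}"
      using Y V_open[of n] unfolding completely_regular_space_alt' by blast
    then show ?thesis using y
      by (intro exI[of _ "\<lambda>z. 1 - f z"]) (auto intro!: continuous_map_diff)
  qed
  then obtain \<phi> where \<phi>: "\<And>n. continuous_map Y euclideanreal (\<phi> n)" "\<And>n. \<exists>y\<in>U. \<phi> n y = 1"
    "\<And>n y. y \<in> topspace Y \<Longrightarrow> y \<notin> V n \<Longrightarrow> \<phi> n y = 0"
    by (metis DiffI)
  have "\<exists>W N. openin Y W \<and> y \<in> W \<and> (\<forall>n\<ge>N. \<forall>z\<in>W. \<phi> n z = 0)" if y: "y \<in> topspace Y" for y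
  proof (cases "y \<in> Y closure_of U")
    case True
    then obtain W where W: "openin ?C W" "y \<in> W" "\<And>w. w \<in> W \<Longrightarrow> \<bar>g w - g y\<bar> < 1"
      using g unfolding continuous_map_real_iff tC by (meson zero_less_one)
    obtain T where T: "openin Y T" "W = T \<inter> Y closure_of U"
      using W(1) unfolding openin_subtopology by blast
    obtain N :: nat where N: "\<bar>g y\<bar> + 1 < real N" using reals_Archimedean2 by blast
    \<comment> \<open>A point of \<open>T\<close> in \<open>V n\<close> lies in the closure of
      \<open>U\<close>, hence in \<open>W\<close>, where \<open>\<bar>g\<bar>\<close> stays below
      \<open>N\<close>.\<close>
    have "\<phi> n z = 0" if "n \<ge> N" "z \<in> T" for n z
    proof (rule \<phi>(3))
      show "z \<in> topspace Y" using T(1) that(2) openin_subset by blast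
      show "z \<notin> V n"
      proof
        assume "z \<in> V n"
        then have "z \<in> W" "real n < \<bar>g z\<bar>" using T(2) that(2) UC by (auto simp: V_def)
        moreover have "real N \<le> real n" using that(1) by simp
        ultimately show False using W(3)[of z] N by linarith
      qed
    qed
    with T W(2) show ?thesis by blast
  next
    case False
    have "openin Y (topspace Y - Y closure_of U)"
      by (simp add: openin_diff closedin_closure_of)
    moreover have "\<phi> n z = 0" if "z \<in> topspace Y - Y closure_of U" for n z
      using that UC by (intro \<phi>(3)) (auto simp: V_def)
    ultimately show ?thesis using y False by blast
  qed
  with \<phi>(1,2) that show thesis by blast
qed

text \<open>Infinitely many sequences \<open>s i\<close>, all converging to the single non-isolated point \<open>p\<close>.
  Points of the type that lie on no sequence are isolated too, so that the space is all of the type.\<close>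

definition fan_topology :: "'b \<Rightarrow> ('i \<Rightarrow> nat \<Rightarrow> 'b) \<Rightarrow> 'b topology" where
  "fan_topology p s = topology (\<lambda>T. p \<in> T \<longrightarrow> (\<forall>i. \<forall>\<^sub>F n in sequentially. s i n \<in> T))"

lemma openin_fan_topology:
  "openin (fan_topology p s) T \<longleftrightarrow> (p \<in> T \<longrightarrow> (\<forall>i. \<forall>\<^sub>F n in sequentially. s i n \<in> T))"
proof -
  have "istopology (\<lambda>T. p \<in> T \<longrightarrow> (\<forall>i. \<forall>\<^sub>F n in sequentially. s i n \<in> T))"
    unfolding istopology_def
  proof (intro conjI allI impI)
    fix \<K> i assume "\<forall>K\<in>\<K>. p \<in> K \<longrightarrow> (\<forall>i. \<forall>\<^sub>F n in sequentially. s i n \<in> K)" "p \<in> \<Union>\<K>"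
    then obtain K where K: "K \<in> \<K>" "\<forall>\<^sub>F n in sequentially. s i n \<in> K" by blast
    then show "\<forall>\<^sub>F n in sequentially. s i n \<in> \<Union>\<K>"
      by (auto elim!: eventually_mono)
  qed (auto simp: eventually_conj_iff)
  then show ?thesis unfolding fan_topology_def by (simp add: topology_inverse')
qed

lemma topspace_fan_topology [simp]: "topspace (fan_topology p s) = UNIV"
proof -
  have "openin (fan_topology p s) UNIV" by (simp add: openin_fan_topology)
  then show ?thesis using openin_subset by blast
qed

section \<open>Properties of the fan\<close>

context
  fixes p :: 'b and s :: "'i \<Rightarrow> nat \<Rightarrow> 'b"
  assumes inj: "\<And>i n j m. s i n = s j m \<longleftrightarrow> i = j \<and> n = m" and p: "\<And>i n. s i n \<noteq> p"
begin

lemma openin_fan_compl_finite: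
  assumes "finite S" "p \<notin> S"
  shows "openin (fan_topology p s) (- S)"
  unfolding openin_fan_topology
proof (intro impI allI)
  fix i
  have "finite (s i -` S)"
    using assms(1) inj by (intro finite_vimageI) (auto simp: inj_def)
  then have "\<forall>\<^sub>F n in sequentially. n \<notin> s i -` S"
    by (metis (no_types, lifting) cofinite_eq_sequentially eventually_cofinite finite_subset mem_Collect_eq not_not subsetI)
  then show "\<forall>\<^sub>F n in sequentially. s i n \<in> - S" by simp
qed

text \<open>Clopen sets form a base: an open set containing \<open>p\<close> has a complement
  avoiding \<open>p\<close>, which is open, and the other singletons are clopen.\<close>

lemma tychonoff_fan: "tychonoff_space (fan_topology p s)"
  unfolding tychonoff_space_def
proof
  let ?X = "fan_topology p s"
  show "completely_regular_space ?X"
    unfolding completely_regular_space_alt'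
  proof (intro allI impI)
    fix S x assume S: "openin ?X S" "x \<in> S"
    obtain T where T: "openin ?X T" "openin ?X (- T)" "x \<in> T" "T \<subseteq> S"
    proof (cases "x = p")
      case True
      then show thesis using S that[of S] by (simp add: openin_fan_topology)
    next
      case False
      then have "openin ?X {x}" by (auto simp: openin_fan_topology)
      then show thesis using that[of "{x}"] S openin_fan_compl_finite[of "{x}"] False by simp
    qed
    have "continuous_map ?X euclideanreal (indicator (- T))"
      unfolding continuous_map_real_iff
    proof (intro ballI allI impI)
      fix z and e :: real
      assume "0 < e"
      with T(1,2) show "\<exists>U. openin ?X U \<and> z \<in> U \<and> (\<forall>w\<in>U. \<bar>indicat_real (- T) w - indicat_real (- T) z\<bar> < e)"
        by (intro exI[of _ "if z \<in> T then T else - T"]) auto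
    qed
    with T(3,4) show "\<exists>f. continuous_map ?X euclideanreal f \<and> f x = 0 \<and> f ` (topspace ?X - S) \<subseteq> {1}"
      by (intro exI[of _ "indicator (- T)"]) (auto simp: indicator_def)
  qed
  show "Hausdorff_space ?X"
    unfolding Hausdorff_space_def
  proof (intro allI impI)
    fix x y assume xy: "x \<in> topspace ?X \<and> y \<in> topspace ?X \<and> x \<noteq> y"
    have sep: "openin ?X {a} \<and> openin ?X (- {a})" if "a \<noteq> p" for a
      using that openin_fan_compl_finite[of "{a}"] by (auto simp: openin_fan_topology)
    show "\<exists>U V. openin ?X U \<and> openin ?X V \<and> x \<in> U \<and> y \<in> V \<and> disjnt U V"
    proof (cases "x = p")
      case True
      then show ?thesis using sep[of y] xy
        by (intro exI[of _ "- {y}"] exI[of _ "{y}"]) auto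
    next
      case False
      then show ?thesis using sep[of x] xy
        by (intro exI[of _ "{x}"] exI[of _ "- {x}"]) (auto simp: disjnt_def)
    qed
  qed
qed

text \<open>Only \<open>p\<close> can be a new closure point. If every sequence eventually left
  \<open>A\<close>, the complement of \<open>A\<close> would be a neighbourhood of \<open>p\<close>;
  so some sequence meets \<open>A\<close> infinitely often and has a subsequence in
  \<open>A\<close>.\<close>

lemma Frechet_Urysohn_fan: "Frechet_Urysohn_space (fan_topology p s)"
  unfolding Frechet_Urysohn_space_def
proof (intro allI impI)
  let ?X = "fan_topology p s"
  fix A a assume A: "A \<subseteq> topspace ?X \<and> a \<in> ?X closure_of A"
  show "\<exists>\<sigma> :: nat \<Rightarrow> 'b. range \<sigma> \<subseteq> A \<and> limitin ?X \<sigma> a sequentially"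
  proof (cases "a \<in> A")
    case True
    then show ?thesis
      by (intro exI[of _ "\<lambda>_. a"]) (auto simp: limitin_sequentially)
  next
    case False
    have meets: "\<exists>y\<in>A. y \<in> T" if "openin ?X T" "a \<in> T" for T
      using A that unfolding in_closure_of by blast
    have "a = p"
    proof (rule ccontr)
      assume "a \<noteq> p"
      then have "openin ?X {a}" by (simp add: openin_fan_topology)
      with meets[of "{a}"] False show False by blast
    qed
    have "\<not> openin ?X (- A)" using meets[of "- A"] False by blast
    then obtain i where "\<exists>\<^sub>F n in sequentially. s i n \<in> A"
      unfolding openin_fan_topology frequently_def by auto
    then have "infinite {n. s i n \<in> A}"
      by (simp add: frequently_cofinite flip: cofinite_eq_sequentially)
    then obtain r :: "nat \<Rightarrow> nat" where r: "strict_mono r" "\<And>n. s i (r n) \<in> A"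
      using infinite_enumerate by blast
    have "limitin ?X (\<lambda>n. s i (r n)) p sequentially"
      unfolding limitin_def openin_fan_topology
      using eventually_subseq[OF r(1)] by auto
    with r(2) \<open>a = p\<close> show ?thesis by (intro exI[of _ "\<lambda>n. s i (r n)"]) auto
  qed
qed

text \<open>One point of \<open>K\<close> chosen on each sequence that meets it gives a closed
  discrete subset \<open>D\<close> of \<open>K\<close>, which compactness forces to be
  finite.\<close>

lemma finite_spikes_compactin_fan:
  assumes K: "compactin (fan_topology p s) K"
  shows "finite {i. \<exists>n. s i n \<in> K}"
proof -
  let ?X = "fan_topology p s" and ?J = "{i. \<exists>n. s i n \<in> K}"
  have "\<forall>i\<in>?J. \<exists>n. s i n \<in> K" by blast
  from bchoice[OF this] obtain r where r: "\<And>i. i \<in> ?J \<Longrightarrow> s i (r i) \<in> K" by blast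
  define D where "D = (\<lambda>i. s i (r i)) ` ?J"
  have "openin ?X (- D)"
    unfolding openin_fan_topology
  proof (intro impI allI)
    fix i
    have "s i n \<notin> D" if "n \<ge> Suc (r i)" for n
      using that by (auto simp: D_def inj)
    then show "\<forall>\<^sub>F n in sequentially. s i n \<in> - D"
      unfolding eventually_sequentially by blast
  qed
  moreover have "openin ?X {d}" if "d \<in> D" for d
    using that p by (auto simp: D_def openin_fan_topology)
  ultimately have "\<forall>U\<in>insert (- D) ((\<lambda>d. {d}) ` D). openin ?X U" by auto
  moreover have "K \<subseteq> \<Union>(insert (- D) ((\<lambda>d. {d}) ` D))" by auto
  ultimately obtain \<F> where \<F>: "finite \<F>" "\<F> \<subseteq> insert (- D) ((\<lambda>d. {d}) ` D)" "K \<subseteq> \<Union>\<F>"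
    using K unfolding compactin_def by meson
  have "(\<lambda>d. {d}) ` D \<subseteq> \<F>"
  proof clarify
    fix d assume "d \<in> D"
    moreover from this have "d \<in> K" using r by (auto simp: D_def)
    ultimately show "{d} \<in> \<F>" using \<F>(2,3) by auto
  qed
  then have "finite ((\<lambda>d. {d}) ` D)" using \<F>(1) finite_subset by blast
  then have "finite D" by (rule finite_imageD) simp
  then show ?thesis unfolding D_def
    by (rule finite_imageD) (auto simp: inj_on_def inj)
qed

section \<open>The discontinuous \<open>k\<close>-continuous function\<close>

text \<open>By \<open>lf\<close>, each sequence separately admits a neighbourhood on which its late
  bumps vanish, which suffices over compact sets. By \<open>peak\<close>, every neighbourhood of
  \<open>y0\<close> contains peaks of all bumps of some sequence.\<close>

lemma not_kR_space_fan_prod: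
  fixes \<phi> :: "'i \<Rightarrow> nat \<Rightarrow> 'a \<Rightarrow> real"
  assumes y0: "y0 \<in> topspace Y"
    and cont: "\<And>i n. continuous_map Y euclideanreal (\<phi> i n)"
    and peak: "\<And>U. openin Y U \<Longrightarrow> y0 \<in> U \<Longrightarrow> \<exists>i. \<forall>n. \<exists>y\<in>U. \<phi> i n y = 1"
    and lf: "\<And>i y. y \<in> topspace Y \<Longrightarrow> \<exists>W N. openin Y W \<and> y \<in> W \<and> (\<forall>n\<ge>N. \<forall>z\<in>W. \<phi> i n z = 0)"
  shows "\<not> kR_space (prod_topology (fan_topology p s) Y)"
proof
  let ?X = "fan_topology p s"
  let ?P = "prod_topology ?X Y"
  \<comment> \<open>The inverse reads off the sequence and the position of a point; \<open>p\<close>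
    and points on no sequence get the value 0.\<close>
  define f where "f = (\<lambda>(x, y). if x \<in> range (case_prod s) then case_prod \<phi> (inv (case_prod s) x) y else 0)"
  have "inj (case_prod s)" by (auto simp: inj_def inj)
  then have f_s: "f (s i n, y) = \<phi> i n y" for i n y
    using inv_f_f[of "case_prod s" "(i, n)"] rangeI[of "case_prod s" "(i, n)"] by (simp add: f_def)
  have f_0: "f (x, y) = 0" if "\<And>i n. x \<noteq> s i n" for x y
    using that by (auto simp: f_def)
  have "k_continuous ?P f"
    unfolding k_continuous_def continuous_map_real_iff
  proof (intro allI impI ballI)
    fix K q and e :: real
    assume K: "compactin ?P K" and q: "q \<in> topspace (subtopology ?P K)" and e: "0 < e"
    obtain x y where xy: "q = (x, y)" "y \<in> topspace Y" "(x, y) \<in> K"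
      using q by auto
    have "\<exists>T W. openin ?X T \<and> openin Y W \<and> x \<in> T \<and> y \<in> W \<and>
        (\<forall>(x', y') \<in> T \<times> W \<inter> K. \<bar>f (x', y') - f (x, y)\<bar> < e)"
    proof (cases "x = p")
      case False
      then have T: "openin ?X {x}" by (simp add: openin_fan_topology)
      have "continuous_map Y euclideanreal (\<lambda>y. f (x, y))"
      proof (cases "\<exists>i n. x = s i n")
        case True
        then show ?thesis using cont by (auto simp: f_s)
      next
        case False
        then have "f (x, y) = 0" for y using f_0[of x] by blast
        then show ?thesis by simp
      qed
      then obtain W where "openin Y W" "y \<in> W" "\<forall>z\<in>W. \<bar>f (x, z) - f (x, y)\<bar> < e"
        using xy e unfolding continuous_map_real_iff by blast
      with T show ?thesis by (intro exI[of _ "{x}"] exI[of _ W]) auto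
    next
      case True
      define J where "J = {i. \<exists>n. s i n \<in> fst ` K}"
      have "compactin ?X (fst ` K)"
        using K by (rule image_compactin) (rule continuous_map_fst)
      then have J: "finite J" unfolding J_def by (rule finite_spikes_compactin_fan)
      obtain W N where WN: "\<And>i. openin Y (W i) \<and> y \<in> W i \<and> (\<forall>n\<ge>N i. \<forall>z\<in>W i. \<phi> i n z = 0)"
        using lf[OF xy(2)] by metis
      \<comment> \<open>Deleting the first \<open>N i\<close> points of the finitely many relevant
        sequences leaves only bumps that vanish on \<open>W i\<close>.\<close>
      let ?S = "\<Union>i\<in>J. s i ` {..<N i}" and ?W = "topspace Y \<inter> \<Inter>(W ` J)"
      have T: "openin ?X (- ?S)"
        using J by (intro openin_fan_compl_finite) (auto simp: p[symmetric])
      have "openin Y ?W"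
        using J WN by (cases "J = {}") (auto intro!: openin_Int openin_INT)
      moreover have "x \<in> - ?S" using True by (auto simp: p[symmetric])
      moreover have "y \<in> ?W" using WN xy(2) by auto
      moreover have "f (x', y') = 0" if "(x', y') \<in> (- ?S) \<times> ?W" "(x', y') \<in> K" for x' y'
      proof (cases "\<exists>i n. x' = s i n")
        case True
        then obtain i n where x': "x' = s i n" by blast
        have "i \<in> J" unfolding J_def using that(2) x' by force
        then have "N i \<le> n" "y' \<in> W i" using that(1) x' by (auto simp: not_less[symmetric])
        then show ?thesis using WN x' by (simp add: f_s)
      next
        case False
        then show ?thesis using f_0 by blast
      qed
      moreover have "f (x, y) = 0" using f_0 p True by metis
      ultimately show ?thesis using T e
        by (intro exI[of _ "- ?S"] exI[of _ ?W]) auto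
    qed
    then obtain T W where TW: "openin ?X T" "openin Y W" "x \<in> T" "y \<in> W"
      "\<forall>(x', y') \<in> T \<times> W \<inter> K. \<bar>f (x', y') - f (x, y)\<bar> < e"
      by blast
    then have "openin ?P (T \<times> W)" by (simp add: openin_prod_Times_iff)
    then have "openin (subtopology ?P K) (T \<times> W \<inter> K)"
      unfolding openin_subtopology by blast
    with TW xy show "\<exists>U. openin (subtopology ?P K) U \<and> q \<in> U \<and> (\<forall>z\<in>U. \<bar>f z - f q\<bar> < e)"
      by (intro exI[of _ "T \<times> W \<inter> K"]) auto
  qed
  moreover assume "kR_space ?P"
  ultimately have "continuous_map ?P euclideanreal f" unfolding kR_space_def by blast
  moreover have "(p, y0) \<in> topspace ?P" using y0 by simp
  ultimately obtain S where S: "openin ?P S" "(p, y0) \<in> S" "\<forall>z\<in>S. \<bar>f z - f (p, y0)\<bar> < 1"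
    unfolding continuous_map_real_iff by (meson zero_less_one)
  from S(1,2) obtain T U where TU: "openin ?X T" "openin Y U" "p \<in> T" "y0 \<in> U" "T \<times> U \<subseteq> S"
    unfolding openin_prod_topology_alt by metis
  obtain i where i: "\<And>n. \<exists>y\<in>U. \<phi> i n y = 1" using peak TU by blast
  have "\<forall>\<^sub>F n in sequentially. s i n \<in> T" using TU unfolding openin_fan_topology by blast
  then obtain n where "s i n \<in> T" by (auto simp: eventually_sequentially)
  moreover obtain y where "y \<in> U" "\<phi> i n y = 1" using i by blast
  moreover have "f (p, y0) = 0" using f_0 p by metis
  ultimately show False using TU(5) S(3) f_s[of i n y] by fastforce
qed

end

section \<open>From products with fans to local pseudocompactness\<close>

text \<open>Used to fit a whole sequence for every subset of \<open>Y\<close> into the type of the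
  test spaces.\<close>

lemma infinite_times_nat_lepoll:
  assumes "infinite A"
  shows "A \<times> (UNIV :: nat set) \<lesssim> A"
proof -
  have "A \<times> (UNIV :: nat set) \<lesssim> A \<times> A"
    using assms by (intro times_lepoll_mono) (simp_all add: infinite_le_lepoll)
  also have "A \<times> A \<lesssim> A"
    using card_of_Times_same_infinite[OF assms]
    by (simp add: eqpoll_imp_lepoll eqpoll_iff_card_of_ordIso)
  finally show ?thesis .
qed

lemma locally_pseudocompact_if_kR_products:
  fixes Y :: "'a topology"
  assumes Y: "completely_regular_space Y"
    and card: "(UNIV :: 'a set set) \<lesssim> (UNIV :: 'b set)"
    and prod: "\<And>X :: 'b topology. tychonoff_space X \<Longrightarrow> Frechet_Urysohn_space X \<Longrightarrow> kR_space (prod_topology X Y)"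
  shows "locally_pseudocompact_space Y"
proof (rule ccontr)
  assume "\<not> locally_pseudocompact_space Y"
  then obtain y0 where y0: "y0 \<in> topspace Y" and not_pc:
    "\<And>U N. openin Y U \<Longrightarrow> y0 \<in> U \<Longrightarrow> U \<subseteq> N \<Longrightarrow> N \<subseteq> topspace Y \<Longrightarrow> \<not> pseudocompact_space (subtopology Y N)"
    unfolding locally_pseudocompact_space_def by meson
  \<comment> \<open>A finite space is pseudocompact and would be a forbidden neighbourhood of
    \<open>y0\<close>.\<close>
  have "infinite (topspace Y)"
    using not_pc[of "topspace Y" "topspace Y"] y0
    by (auto simp: pseudocompact_space_def intro: finite_imp_bounded)
  then have "infinite (UNIV :: 'a set)" by (rule infinite_super[OF subset_UNIV])
  then have "infinite (UNIV :: 'a set set)" by (simp add: finite_Pow_iff flip: Pow_UNIV)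
  from infinite_times_nat_lepoll[OF this] card
  have "(UNIV :: 'a set set) \<times> (UNIV :: nat set) \<lesssim> (UNIV :: 'b set)"
    by (rule lepoll_trans)
  then obtain c :: "'a set \<times> nat \<Rightarrow> 'b" where c: "inj c"
    unfolding lepoll_def by auto
  \<comment> \<open>The shift by \<open>Suc\<close> frees \<open>c ({}, 0)\<close> to be the vertex,
    off every sequence.\<close>
  define s where "s U n = c (U, Suc n)" for U n
  define p where "p = c ({}, 0)"
  have s: "s U n = s V m \<longleftrightarrow> U = V \<and> n = m" and p: "s U n \<noteq> p" for U V n m
    using c by (auto simp: s_def p_def inj_eq)
  \<comment> \<open>The fan is indexed by all sets \<open>U\<close>; those that are not open
    neighbourhoods of \<open>y0\<close> receive zero functions.\<close>
  have bumps: "\<forall>U. \<exists>\<phi> :: nat \<Rightarrow> 'a \<Rightarrow> real. (\<forall>n. continuous_map Y euclideanreal (\<phi> n)) \<and>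
      (openin Y U \<and> y0 \<in> U \<longrightarrow> (\<forall>n. \<exists>y\<in>U. \<phi> n y = 1)) \<and>
      (\<forall>y\<in>topspace Y. \<exists>W N. openin Y W \<and> y \<in> W \<and> (\<forall>n\<ge>N. \<forall>z\<in>W. \<phi> n z = 0))"
    (is "\<forall>U. \<exists>\<phi>. ?Q U \<phi>")
  proof
    fix U
    show "\<exists>\<phi>. ?Q U \<phi>"
    proof (cases "openin Y U \<and> y0 \<in> U")
      case True
      then have "U \<subseteq> Y closure_of U" by (simp add: closure_of_subset openin_subset)
      with True have npc: "\<not> pseudocompact_space (subtopology Y (Y closure_of U))"
        using not_pc closure_of_subset_topspace by metis
      show ?thesis
      proof (rule nonpseudocompact_bumps[OF Y conjunct1[OF True] npc])
        fix \<phi> :: "nat \<Rightarrow> 'a \<Rightarrow> real"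
        assume "\<And>n. continuous_map Y euclideanreal (\<phi> n)" "\<And>n. \<exists>y\<in>U. \<phi> n y = 1"
          "\<And>y. y \<in> topspace Y \<Longrightarrow> \<exists>W N. openin Y W \<and> y \<in> W \<and> (\<forall>n\<ge>N. \<forall>z\<in>W. \<phi> n z = 0)"
        then show ?thesis by (intro exI[of _ \<phi>] conjI allI ballI impI)
      qed
    next
      case False
      then show ?thesis by (intro exI[of _ "\<lambda>n y. 0"]) auto
    qed
  qed
  from choice[OF bumps] obtain \<phi> where \<phi>: "\<forall>U. ?Q U (\<phi> U)" ..
  have "continuous_map Y euclideanreal (\<phi> U n)" for U n
    using \<phi> by simp
  moreover have "\<exists>U. \<forall>n. \<exists>y\<in>V. \<phi> U n y = 1" if "openin Y V" "y0 \<in> V" for V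
    using \<phi> that by (intro exI[of _ V]) simp
  moreover have "\<exists>W N. openin Y W \<and> y \<in> W \<and> (\<forall>n\<ge>N. \<forall>z\<in>W. \<phi> U n z = 0)"
    if "y \<in> topspace Y" for U y
    using \<phi> that by simp
  ultimately have "\<not> kR_space (prod_topology (fan_topology p s) Y)"
    by (intro not_kR_space_fan_prod[OF s p y0])
  then show False
    using prod tychonoff_fan[OF s p] Frechet_Urysohn_fan[OF s p] by blast
qed

theorem theorem4p6:
  fixes Y :: "'a topology"
  assumes "tychonoff_space Y"
  shows
    "(locally_pseudocompact_space Y \<and> kR_space Y \<longrightarrow>
       (\<forall>X :: 'b topology. tychonoff_space X \<and> kR_space X \<longrightarrow> kR_space (prod_topology X Y)))
     \<and>
     ((\<forall>X :: 'b topology. tychonoff_space X \<and> kR_space X \<longrightarrow> kR_space (prod_topology X Y)) \<longrightarrow>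
       (\<forall>X :: 'b topology. tychonoff_space X \<and> Frechet_Urysohn_space X \<longrightarrow> kR_space (prod_topology X Y)))
     \<and>
     ((UNIV :: 'a set set) \<lesssim> (UNIV :: 'b set) \<longrightarrow>
       (\<forall>X :: 'b topology. tychonoff_space X \<and> Frechet_Urysohn_space X \<longrightarrow> kR_space (prod_topology X Y)) \<longrightarrow>
       locally_pseudocompact_space Y \<and> kR_space Y)"
proof (intro conjI impI allI; (elim conjE)?)
  fix X :: "'b topology"
  assume "locally_pseudocompact_space Y" "kR_space Y" "kR_space X"
  then show "kR_space (prod_topology X Y)" by (intro kR_space_prod)
next
  fix X :: "'b topology"
  assume "\<forall>X :: 'b topology. tychonoff_space X \<and> kR_space X \<longrightarrow> kR_space (prod_topology X Y)"
    and "tychonoff_space X" "Frechet_Urysohn_space X"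
  then show "kR_space (prod_topology X Y)" using Frechet_Urysohn_imp_kR_space by blast
next
  assume "(UNIV :: 'a set set) \<lesssim> (UNIV :: 'b set)"
    and "\<forall>X :: 'b topology. tychonoff_space X \<and> Frechet_Urysohn_space X \<longrightarrow> kR_space (prod_topology X Y)"
  then show "locally_pseudocompact_space Y"
    using assms locally_pseudocompact_if_kR_products unfolding tychonoff_space_def by blast
next
  assume prod: "\<forall>X :: 'b topology. tychonoff_space X \<and> Frechet_Urysohn_space X \<longrightarrow> kR_space (prod_topology X Y)"
  \<comment> \<open>A one-point test space transfers the \<open>k\<^sub>R\<close>-property from the
    product to \<open>Y\<close>.\<close>
  define X :: "'b topology" where "X = discrete_topology {undefined}"
  have "completely_regular_space X"
    unfolding completely_regular_space_alt' X_def by (auto intro!: exI[of _ "\<lambda>_. 0"])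
  moreover have "Hausdorff_space X" unfolding X_def by (rule Hausdorff_space_discrete_topology)
  moreover have "Frechet_Urysohn_space X"
    unfolding Frechet_Urysohn_space_def X_def
    by (auto simp: limitin_sequentially discrete_topology_closure_of intro!: exI[of _ "\<lambda>_. undefined"])
  ultimately have "kR_space (prod_topology X Y)" using prod unfolding tychonoff_space_def by blast
  then show "kR_space Y" by (rule kR_space_prodD) (simp add: X_def)
qed

end
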